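(* Let $x\ge4$ be an integer such that $N=\binom{x}{\lfloor x/2\rfloor}$ is even, and let $\mathcal E_N$ be the graph on $N$ vertices consisting of $N/2$ pairwise disjoint edges. Then $t(\mathcal E_N)=x+1=t_e(\mathcal E_N)+2$.
   Context: For a finite simple graph $G$, a family of subsets $B_v\subseteq[1,t]=\{1,\dots,t\}$, one for each vertex $v$, is a $G$-ECFF$(t,|V(G)|)$ if for every edge $\{a,b\}$ and every vertex $w\notin\{a,b\}$, $B_w\not\subseteq B_a\cup B_b$; it is a $G$-CFF$(t,|V(G)|)$ if in addition $B_a\not\subseteq B_b$ and $B_b\not\subseteq B_a$ for every edge $\{a,b\}$. $t_e(G)$ and $t(G)$ denote the minimum $t$ for which a $G$-ECFF, respectively a $G$-CFF, on $|V(G)|$ sets exists. *)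

theory Defs
  imports "Graph_Theory.Pair_Digraph" "HOL-Library.Disjoint_Sets"
begin

text \<open>
  A finite simple graph is a \<^term>\<open>pair_graph\<close> (finite, symmetric, loop-free, no parallel arcs);
  the edge \<open>{a, b}\<close> is represented by the two arcs \<open>(a, b)\<close> and \<open>(b, a)\<close>.
\<close>

definition uedges :: "'a pair_pre_digraph \<Rightarrow> 'a set set" where
  "uedges G = {{a, b} | a b. (a, b) \<in> parcs G}"

text \<open>
  Families are indexed by the vertices, so repeated sets are allowed; the values of \<open>B\<close> outside
  \<open>pverts G\<close> play no role.
\<close>

definition is_ecff :: "'a pair_pre_digraph \<Rightarrow> nat \<Rightarrow> ('a \<Rightarrow> nat set) \<Rightarrow> bool" where
  "is_ecff G t B \<longleftrightarrow>
     (\<forall>v\<in>pverts G. B v \<subseteq> {1..t}) \<and>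
     (\<forall>a b w. {a, b} \<in> uedges G \<longrightarrow> w \<in> pverts G - {a, b} \<longrightarrow> \<not> B w \<subseteq> B a \<union> B b)"

definition is_cff :: "'a pair_pre_digraph \<Rightarrow> nat \<Rightarrow> ('a \<Rightarrow> nat set) \<Rightarrow> bool" where
  "is_cff G t B \<longleftrightarrow>
     is_ecff G t B \<and>
     (\<forall>a b. {a, b} \<in> uedges G \<longrightarrow> \<not> B a \<subseteq> B b \<and> \<not> B b \<subseteq> B a)"

definition t_ecff :: "'a pair_pre_digraph \<Rightarrow> nat" where
  "t_ecff G = (LEAST t. \<exists>B. is_ecff G t B)"

definition t_cff :: "'a pair_pre_digraph \<Rightarrow> nat" where
  "t_cff G = (LEAST t. \<exists>B. is_cff G t B)"

text \<open>
  For even \<open>n\<close>, the following determines the graph on \<open>n\<close> vertices consisting of \<open>n / 2\<close>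
  pairwise disjoint edges up to isomorphism.
\<close>

definition disjoint_edges_graph :: "nat \<Rightarrow> 'a pair_pre_digraph \<Rightarrow> bool" where
  "disjoint_edges_graph n G \<longleftrightarrow>
     pair_graph G \<and> card (pverts G) = n \<and> card (uedges G) = n div 2 \<and> disjoint (uedges G)"

text \<open>The minima defining \<^const>\<open>t_ecff\<close> and \<^const>\<open>t_cff\<close> are attained.\<close>

lemma ex_is_cff:
  assumes "pair_graph G"
  shows "\<exists>B. is_cff G (card (pverts G)) B"
proof -
  interpret pair_graph G by fact
  obtain f where f: "bij_betw f (pverts G) {1..card (pverts G)}"
    using ex_bij_betw_finite_nat[OF pair_finite_verts]
    by (metis card_atLeastAtMost diff_Suc_1 finite_atLeastAtMost finite_same_card_bij
        pair_finite_verts)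
  have mem: "a \<in> pverts G" "b \<in> pverts G" "a \<noteq> b" if "{a, b} \<in> uedges G" for a b
  proof -
    obtain u v where "{a, b} = {u, v}" "(u, v) \<in> parcs G"
      using \<open>{a, b} \<in> uedges G\<close> by (auto simp: uedges_def)
    moreover from this(2) have "u \<in> pverts G" "v \<in> pverts G" "u \<noteq> v"
      using in_arcsD1 in_arcsD2 pair_no_loops[of "(u, v)"] by auto
    ultimately show "a \<in> pverts G" "b \<in> pverts G" "a \<noteq> b"
      by (auto simp: doubleton_eq_iff)
  qed
  have eq: "f u = f v \<longleftrightarrow> u = v" if "u \<in> pverts G" "v \<in> pverts G" for u v
    using f that by (auto simp: bij_betw_def inj_on_def)
  have "is_cff G (card (pverts G)) (\<lambda>v. {f v})"
    unfolding is_cff_def is_ecff_def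
    using bij_betwE[OF f] by (auto dest: mem) (metis mem eq)+
  then show ?thesis by blast
qed

lemma t_cff_attained:
  assumes "pair_graph G"
  shows "\<exists>B. is_cff G (t_cff G) B"
  unfolding t_cff_def by (rule LeastI_ex) (use ex_is_cff[OF assms] in blast)

lemma t_ecff_attained:
  assumes "pair_graph G"
  shows "\<exists>B. is_ecff G (t_ecff G) B"
  unfolding t_ecff_def
  by (rule LeastI_ex) (use ex_is_cff[OF assms] in \<open>auto simp: is_cff_def\<close>)

text \<open>Such graphs exist.\<close>

lemma ex_disjoint_edges_graph:
  assumes "even n"
  shows "\<exists>G :: nat pair_pre_digraph. disjoint_edges_graph n G"
proof -
  obtain m where n: "n = 2 * m" using assms by blast
  define A where "A = (\<lambda>i. (2 * i, 2 * i + 1)) ` {..<m} \<union> (\<lambda>i. (2 * i + 1, 2 * i)) ` {..<m}"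
  define G where "G = \<lparr>pverts = {..<n}, parcs = A\<rparr>"
  have "pair_graph G"
    by unfold_locales (auto simp: G_def A_def n symmetric_def intro!: symI)
  moreover have ue: "uedges G = (\<lambda>i. {2 * i, 2 * i + 1}) ` {..<m}"
    by (auto simp: uedges_def G_def A_def insert_commute)
  moreover have "inj_on (\<lambda>i::nat. {2 * i, 2 * i + 1}) {..<m}"
    by (rule inj_onI) (auto simp: doubleton_eq_iff)
  then have "card (uedges G) = m"
    unfolding ue by (simp add: card_image)
  moreover have "disjoint (uedges G)"
    unfolding ue by (rule disjointI) (auto, presburger+)
  ultimately show ?thesis
    by (auto simp: disjoint_edges_graph_def G_def n)
qed

end

theory Submission
  imports Defs Complex_Main
begin

text \<open>
  For the lower bound on \<^const>\<open>t_ecff\<close>, one set from each edge gives an antichain.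
  For the lower bound on \<^const>\<open>t_cff\<close>, all \<open>N\<close> sets form an antichain on \<open>x\<close> points, of the
  largest size that Sperner's theorem permits, so equality holds in the
  Lubell--Yamamoto--Meshalkin inequality.  In terms of maximal chains, every maximal chain then
  meets the family; but the chains through the union \<open>U\<close> of the two sets of an edge can only meet
  the family in these two sets, and since \<open>card U \<ge> 3\<close> some chain avoids both.
  For the upper bounds, assign distinct sets of the middle layer of \<open>{1..x - 1}\<close> to the edges and, for a
  CFF, distinguish the two ends of each edge by the additional points \<open>x\<close> and \<open>x + 1\<close>.
\<close>

section \<open>The Lubell--Yamamoto--Meshalkin inequality\<close>

definition antichain :: "'a set set \<Rightarrow> bool" where
  "antichain F \<longleftrightarrow> (\<forall>A\<in>F. \<forall>B\<in>F. A \<subseteq> B \<longrightarrow> A = B)"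

text \<open>
  For an antichain, this is the proportion of maximal chains of subsets of \<open>S\<close> that meet \<open>F\<close>.
\<close>

definition lubell :: "'a set set \<Rightarrow> 'a set \<Rightarrow> real" where
  "lubell F S = (\<Sum>A | A \<in> F \<and> A \<subseteq> S. 1 / real (card S choose card A))"

lemma finite_members_below: "finite S \<Longrightarrow> finite {A. A \<in> F \<and> A \<subseteq> S}"
  by (rule finite_subset[of _ "Pow S"]) auto

text \<open>A random maximal chain of subsets of \<open>S\<close> passes through
  \<open>S - {s}\<close> for a uniformly chosen \<open>s\<close>, and \<open>S\<close> itself is no
  member. So the expected number of members met is the mean of the values one level down. The proof
  double counts pairs of a member \<open>A\<close> and a point \<open>s\<close> outside it.\<close>

lemma lubell_average:
  assumes fin: "finite S" and notin: "S \<notin> F"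
  shows "real (card S) * lubell F S = (\<Sum>s\<in>S. lubell F (S - {s}))"
proof -
  let ?n = "card S"
  let ?F = "{A. A \<in> F \<and> A \<subseteq> S}"
  let ?g = "\<lambda>A. 1 / real (?n - 1 choose card A)"
  have fF: "finite ?F" using fin by (rule finite_members_below)
  have "(\<Sum>s\<in>S. lubell F (S - {s})) = (\<Sum>s\<in>S. \<Sum>A\<in>?F. if s \<notin> A then ?g A else 0)"
  proof (rule sum.cong[OF refl])
    fix s assume "s \<in> S"
    then have "lubell F (S - {s}) = (\<Sum>A | A \<in> ?F \<and> s \<notin> A. ?g A)"
      unfolding lubell_def by (intro sum.cong) (auto simp: fin)
    also have "\<dots> = (\<Sum>A\<in>?F. if s \<notin> A then ?g A else 0)"
      by (rule sum.inter_filter[OF fF])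
    finally show "lubell F (S - {s}) = \<dots>" .
  qed
  also have "\<dots> = (\<Sum>A\<in>?F. \<Sum>s\<in>S. if s \<notin> A then ?g A else 0)"
    by (rule sum.swap)
  also have "\<dots> = (\<Sum>A\<in>?F. real ?n * (1 / real (?n choose card A)))"
  proof (rule sum.cong[OF refl])
    fix A assume A: "A \<in> ?F"
    \<comment> \<open>As \<open>S\<close> is no member, \<open>A\<close> is a proper subset, which
      keeps the denominator in \<open>?g A\<close> nonzero.\<close>
    then have "A \<subset> S" using notin by auto
    then have less: "card A < ?n" by (rule psubset_card_mono[OF fin])
    have "(\<Sum>s\<in>S. if s \<notin> A then ?g A else 0) = (\<Sum>s | s \<in> S \<and> s \<notin> A. ?g A)"
      by (rule sum.inter_filter[OF fin, symmetric])
    also have "{s. s \<in> S \<and> s \<notin> A} = S - A" by auto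
    also have "(\<Sum>s\<in>S - A. ?g A) = real (?n - card A) * ?g A"
      using card_Diff_subset[OF finite_subset[OF _ fin], of A] A by simp
    also have "\<dots> = real ?n * (1 / real (?n choose card A))"
    proof -
      have "real ((?n - card A) * (?n choose card A)) = real (?n * (?n - 1 choose card A))"
        by (simp only: binomial_absorb_comp)
      then show ?thesis using less by (simp add: field_simps)
    qed
    finally show "(\<Sum>s\<in>S. if s \<notin> A then ?g A else 0) = \<dots>" .
  qed
  also have "\<dots> = real ?n * lubell F S"
    unfolding lubell_def by (rule sum_distrib_left[symmetric])
  finally show ?thesis by simp
qed

lemma lubell_member:
  assumes "antichain F" "S \<in> F"
  shows "lubell F S = 1"
proof -
  have "{A. A \<in> F \<and> A \<subseteq> S} = {S}" using assms by (auto simp: antichain_def)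
  then show ?thesis by (simp add: lubell_def)
qed

text \<open>Induction on \<open>S\<close>: the value is 1 at a member, and elsewhere it is a mean of
  values that are at most 1.\<close>

lemma lubell_le_1:
  assumes "finite S" "antichain F"
  shows "lubell F S \<le> 1"
  using assms(1)
proof (induction S rule: finite_psubset_induct)
  case (psubset S)
  show ?case
  proof (cases "S \<in> F")
    case True
    then show ?thesis using assms(2) by (simp add: lubell_member)
  next
    case False
    show ?thesis
    proof (cases "S = {}")
      case True
      then have "{A. A \<in> F \<and> A \<subseteq> S} = {}" using False by auto
      then show ?thesis by (simp only: lubell_def sum.empty)
    next
      case ne: False
      have "real (card S) * lubell F S = (\<Sum>s\<in>S. lubell F (S - {s}))"
        by (rule lubell_average[OF psubset.hyps False])
      also have "\<dots> \<le> (\<Sum>s\<in>S. 1)"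
        by (rule sum_mono) (use psubset.IH in auto)
      finally show ?thesis
        using ne psubset.hyps by (simp add: card_gt_0_iff)
    qed
  qed
qed

text \<open>A mean of numbers that are at most 1 equals 1 only if all of them do.\<close>

lemma lubell_eq_1_remove:
  assumes "finite S" "antichain F" "S \<notin> F" "lubell F S = 1" "s \<in> S"
  shows "lubell F (S - {s}) = 1"
proof -
  have "(\<Sum>s\<in>S. 1 - lubell F (S - {s})) = 0"
    using lubell_average[OF assms(1,3)] assms(4) by (simp add: sum_subtractf)
  then have "\<forall>s\<in>S. 1 - lubell F (S - {s}) = 0"
    using assms(1,2) by (subst (asm) sum_nonneg_eq_0_iff) (auto intro: lubell_le_1)
  then show ?thesis using assms(5) by simp
qed

text \<open>Remove the points outside \<open>U\<close> one at a time. The member \<open>A\<close>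
  strictly below \<open>U\<close> prevents every set on the way from being a member, so
  \<open>lubell_eq_1_remove\<close> applies each time.\<close>

lemma lubell_eq_1_subset:
  assumes "finite S" "antichain F" "lubell F S = 1" "U \<subseteq> S" "A \<in> F" "A \<subset> U"
  shows "lubell F U = 1"
  using assms(1,3,4)
proof (induction S rule: finite_psubset_induct)
  case (psubset S)
  show ?case
  proof (cases "U = S")
    case False
    then obtain s where s: "s \<in> S" "s \<notin> U" using psubset.prems by auto
    have "A \<subset> S" using assms(6) psubset.prems by blast
    then have "S \<notin> F" using assms(2,5) by (auto simp: antichain_def)
    then have "lubell F (S - {s}) = 1"
      by (rule lubell_eq_1_remove[OF psubset.hyps assms(2) _ psubset.prems(1) s(1)])
    moreover have "S - {s} \<subset> S" "U \<subseteq> S - {s}" using psubset.prems(2) s by auto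
    ultimately show ?thesis by (intro psubset.IH)
  qed (use psubset.prems in simp)
qed

section \<open>Sperner's theorem and its case of equality\<close>

lemma lubell_ge_card:
  assumes "finite S" "F \<subseteq> Pow S"
  shows "real (card F) / real (card S choose (card S div 2)) \<le> lubell F S"
proof -
  have "real (card F) / real (card S choose (card S div 2))
      = (\<Sum>A\<in>F. 1 / real (card S choose (card S div 2)))"
    by simp
  also have "\<dots> \<le> (\<Sum>A\<in>F. 1 / real (card S choose card A))"
    using assms by (intro sum_mono divide_left_mono)
      (auto simp: binomial_maximum card_mono simp flip: of_nat_mult)
  also have "\<dots> = lubell F S"
    unfolding lubell_def using assms(2) by (intro sum.cong) auto
  finally show ?thesis .
qed

lemma sperner:
  assumes "finite S" "F \<subseteq> Pow S" "antichain F"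
  shows "card F \<le> card S choose (card S div 2)"
  using order_trans[OF lubell_ge_card lubell_le_1, OF assms(1,2,1,3)]
  by (simp add: divide_le_eq)

lemma sperner_eq_lubell:
  assumes "finite S" "F \<subseteq> Pow S" "antichain F" "card F = card S choose (card S div 2)"
  shows "lubell F S = 1"
proof -
  have "real (card F) / real (card S choose (card S div 2)) = 1"
    unfolding assms(4) by (rule divide_self) simp
  then show ?thesis
    using lubell_ge_card[OF assms(1,2)] lubell_le_1[OF assms(1,3)] by linarith
qed

text \<open>Each summand of \<open>lubell F S\<close> is at least the reciprocal of the central
  binomial coefficient. Both sums over \<open>F\<close> are 1, so they agree term by term. This
  later excludes members of size 1.\<close>

lemma sperner_eq_choose:
  assumes "finite S" "F \<subseteq> Pow S" "antichain F" "card F = card S choose (card S div 2)" "A \<in> F"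
  shows "card S choose card A = card S choose (card S div 2)"
proof -
  let ?m = "card S choose (card S div 2)"
  have fF: "finite F" using assms(1,2) finite_subset by blast
  have ge: "1 / real ?m \<le> 1 / real (card S choose card A)" if "A \<in> F" for A
    using assms(1,2) that by (intro divide_left_mono)
      (auto simp: binomial_maximum card_mono simp flip: of_nat_mult)
  have "lubell F S = (\<Sum>A\<in>F. 1 / real (card S choose card A))"
    unfolding lubell_def using assms(2) by (intro sum.cong) auto
  moreover have "(\<Sum>A\<in>F. 1 / real ?m) = 1"
    using assms(4) by simp
  ultimately have "(\<Sum>A\<in>F. 1 / real (card S choose card A) - 1 / real ?m) = 0"
    using sperner_eq_lubell[OF assms(1-4)] by (simp only: sum_subtractf)
  then have "\<forall>A\<in>F. 1 / real (card S choose card A) - 1 / real ?m = 0"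
    using ge fF by (subst (asm) sum_nonneg_eq_0_iff) auto
  then show ?thesis using assms(5) by simp
qed

section \<open>Unions of two members of an extremal antichain\<close>

lemma choose_ge_self: "0 < k \<Longrightarrow> k < n \<Longrightarrow> n \<le> n choose k"
proof (induction n arbitrary: k)
  case (Suc n)
  then obtain j where j: "k = Suc j" by (cases k) auto
  show ?case
  proof (cases "k = n")
    case False
    then have "n \<le> n choose k" "0 < n choose j" using Suc j by auto
    then show ?thesis unfolding j binomial_Suc_Suc by linarith
  qed simp
qed simp

text \<open>\<open>A\<close> and \<open>B\<close> are nonempty proper subsets of a union with at
  least 3 points, so each contributes at most 1/3.\<close>

lemma lubell_union_less_1:
  assumes "finite A" "finite B" "\<not> A \<subseteq> B" "\<not> B \<subseteq> A" "2 \<le> card A"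
    and only: "{C. C \<in> F \<and> C \<subseteq> A \<union> B} = {A, B}"
  shows "lubell F (A \<union> B) < 1"
proof -
  let ?u = "card (A \<union> B)"
  have lt: "card A < ?u" "card B < ?u"
    using assms(1-4) by (auto intro!: psubset_card_mono)
  have "B \<noteq> {}" using assms(4) by auto
  then have pos: "0 < card A" "0 < card B" using assms(2,5) by (simp_all add: card_gt_0_iff[of B])
  have "3 \<le> ?u choose card A" "3 \<le> ?u choose card B"
    using choose_ge_self[OF pos(1) lt(1)] choose_ge_self[OF pos(2) lt(2)] lt assms(5) by linarith+
  moreover have "1 / real c \<le> 1 / 3" if "3 \<le> c" for c :: nat
    using that by (intro frac_le) auto
  ultimately have "1 / real (?u choose card A) \<le> 1 / 3" "1 / real (?u choose card B) \<le> 1 / 3"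
    by blast+
  moreover have "A \<noteq> B" using assms(3) by auto
  then have "lubell F (A \<union> B) = 1 / real (?u choose card A) + 1 / real (?u choose card B)"
    unfolding lubell_def only by simp
  ultimately show ?thesis by simp
qed

text \<open>If \<open>A\<close> and \<open>B\<close> were alone below their union, the value there
  would be less than 1, whereas equality at \<open>S\<close> descends to every set strictly above a
  member.\<close>

lemma extremal_antichain_third_below_union:
  assumes "finite S" "4 \<le> card S" "F \<subseteq> Pow S" "antichain F"
    and "card F = card S choose (card S div 2)" and "A \<in> F" "B \<in> F" "A \<noteq> B"
  shows "\<exists>C\<in>F - {A, B}. C \<subseteq> A \<union> B"
proof (rule ccontr)
  assume "\<not> ?thesis"
  then have only: "{C. C \<in> F \<and> C \<subseteq> A \<union> B} = {A, B}" using assms(6,7) by auto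
  have nsub: "\<not> A \<subseteq> B" "\<not> B \<subseteq> A" using assms(4,6-8) by (auto simp: antichain_def)
  have fin: "finite A" "finite B" using assms(1,3,6,7) by (auto intro: finite_subset)
  have "card S choose 2 \<le> card S choose card A"
    using sperner_eq_choose[OF assms(1,3-6)] by (simp add: binomial_maximum)
  \<comment> \<open>This needs at least 4 points: for 3 points the singletons form an extremal
    antichain that violates the claim.\<close>
  moreover have "card S < card S choose 2"
  proof -
    have "card S * 3 \<le> card S * (card S - 1)" using assms(2) by (intro mult_left_mono) auto
    then show ?thesis using assms(2) unfolding choose_two by linarith
  qed
  ultimately have "card S < card S choose card A" by linarith
  then have "card A \<noteq> 1" by auto
  moreover have "card A \<noteq> 0" using fin nsub by auto
  ultimately have "2 \<le> card A" by linarith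
  then have "lubell F (A \<union> B) < 1" using lubell_union_less_1[OF fin nsub _ only] by simp
  moreover have "lubell F (A \<union> B) = 1"
    using assms nsub
    by (intro lubell_eq_1_subset[OF assms(1,4) sperner_eq_lubell[OF assms(1,3-5)] _ assms(6)]) auto
  ultimately show False by simp
qed

section \<open>Central binomial coefficients\<close>

text \<open>Pascal's rule gives two summands, each at most the central coefficient.\<close>

lemma central_binomial_Suc_le:
  "(Suc n) choose (Suc n div 2) \<le> 2 * (n choose (n div 2))"
proof (cases "Suc n div 2")
  case (Suc k)
  have "n choose k \<le> n choose (n div 2)" "n choose Suc k \<le> n choose (n div 2)"
    by (rule binomial_maximum)+
  then show ?thesis unfolding Suc by simp
qed simp

text \<open>Pascal's rule applied twice yields the central coefficient of \<open>n\<close> twice,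
  plus its two neighbours; the upper neighbour is positive as \<open>2 \<le> n\<close>.\<close>

lemma central_binomial_add2_gt:
  assumes "2 \<le> n"
  shows "2 * (n choose (n div 2)) < (n + 2) choose ((n + 2) div 2)"
proof -
  obtain k where k: "n div 2 = Suc k" using assms by (cases "n div 2") auto
  have "0 < n choose Suc (Suc k)" using k assms by auto
  then show ?thesis using k by simp
qed

section \<open>Disjoint edges\<close>

text \<open>The edges cover all vertices by counting: \<open>n div 2\<close> disjoint pairs have
  \<open>n\<close> points in all, for even \<open>n\<close>.\<close>

lemma disjoint_edges_graphD:
  assumes "disjoint_edges_graph n G" "even n"
  shows uedge_card: "e \<in> uedges G \<Longrightarrow> card e = 2"
    and Union_uedges: "\<Union>(uedges G) = pverts G"
    and finite_uedges: "finite (uedges G)"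
proof -
  interpret pair_graph G using assms by (simp add: disjoint_edges_graph_def)
  have two: "card e = 2" if "e \<in> uedges G" for e
    using that pair_no_loops by (auto simp: uedges_def)
  have sub: "\<Union>(uedges G) \<subseteq> pverts G"
    using in_arcsD1 in_arcsD2 by (fastforce simp: uedges_def)
  have "finite (uedges G)"
    by (rule finite_subset[of _ "Pow (pverts G)"]) (use sub in auto)
  then show "finite (uedges G)" .
  have "card (\<Union>(uedges G)) = (\<Sum>e\<in>uedges G. card e)"
    by (rule card_Union_disjoint) (use assms two in
      \<open>auto simp: disjoint_edges_graph_def disjoint_def pairwise_def disjnt_def intro!: card_ge_0_finite\<close>)
  also have "\<dots> = n"
    using two assms by (simp add: disjoint_edges_graph_def)
  finally show "\<Union>(uedges G) = pverts G"
    using sub assms pair_finite_verts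
    by (intro card_subset_eq) (auto simp: disjoint_edges_graph_def)
  show "e \<in> uedges G \<Longrightarrow> card e = 2" by (rule two)
qed

definition edge_of :: "'a pair_pre_digraph \<Rightarrow> 'a \<Rightarrow> 'a set" where
  "edge_of G v = (THE e. e \<in> uedges G \<and> v \<in> e)"

lemma edge_of_eq:
  assumes "disjoint_edges_graph n G" "e \<in> uedges G" "v \<in> e"
  shows "edge_of G v = e"
  unfolding edge_of_def
proof (rule the_equality)
  show "e \<in> uedges G \<and> v \<in> e" using assms by simp
  show "f = e" if "f \<in> uedges G \<and> v \<in> f" for f
    using assms that unfolding disjoint_edges_graph_def disjoint_def by blast
qed

lemma edge_of_mem:
  assumes "disjoint_edges_graph n G" "even n" "v \<in> pverts G"
  shows "edge_of G v \<in> uedges G" "v \<in> edge_of G v"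
proof -
  obtain e where "e \<in> uedges G" "v \<in> e" using Union_uedges[OF assms(1,2)] assms(3) by auto
  then show "edge_of G v \<in> uedges G" "v \<in> edge_of G v" using edge_of_eq[OF assms(1)] by auto
qed

section \<open>Constructions for the upper bounds\<close>

lemma ex_uniform_edge_labelling:
  assumes "finite (uedges G)" "card (uedges G) \<le> t choose k"
  shows "\<exists>g. inj_on g (uedges G) \<and> (\<forall>e\<in>uedges G. g e \<subseteq> {1..t} \<and> card (g e) = k)"
proof -
  let ?L = "{S. S \<subseteq> {1..t} \<and> card S = k}"
  have "finite ?L" by (rule finite_subset[of _ "Pow {1..t}"]) auto
  moreover have "card ?L = t choose k" using n_subsets[of "{1..t}" k] by simp
  ultimately obtain g where "g ` uedges G \<subseteq> ?L" "inj_on g (uedges G)"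
    using card_le_inj[OF assms(1), of ?L] assms(2) by auto
  then show ?thesis by (intro exI[of _ g]) (simp add: image_subset_iff)
qed

lemma inj_uniform_not_subset:
  assumes "inj_on g E" "\<forall>e\<in>E. g e \<subseteq> {1..t::nat} \<and> card (g e) = k" "e \<in> E" "f \<in> E" "e \<noteq> f"
  shows "\<not> g e \<subseteq> g f"
proof
  assume "g e \<subseteq> g f"
  moreover have "finite (g f)" using assms(2,4) finite_subset by blast
  ultimately have "g e = g f" using assms(2-4) by (intro card_subset_eq) auto
  then show False using assms(1,3-5) by (auto dest: inj_onD)
qed

text \<open>Both ends of an edge receive the label of the edge, so their union is one label, and
  this contains no other label of the same size.\<close>

lemma ex_ecff_disjoint_edges:
  assumes G: "disjoint_edges_graph n G" "even n" and "n div 2 \<le> t choose k"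
  shows "\<exists>B. is_ecff G t B"
proof -
  obtain g where g: "inj_on g (uedges G)" "\<forall>e\<in>uedges G. g e \<subseteq> {1..t} \<and> card (g e) = k"
    using ex_uniform_edge_labelling[OF finite_uedges[OF G], of t k] assms
    by (auto simp: disjoint_edges_graph_def)
  have "is_ecff G t (\<lambda>v. g (edge_of G v))"
    unfolding is_ecff_def
  proof (intro conjI ballI allI impI)
    fix v assume "v \<in> pverts G"
    then show "g (edge_of G v) \<subseteq> {1..t}" using g(2) edge_of_mem[OF G] by blast
  next
    fix a b w assume ab: "{a, b} \<in> uedges G" and w: "w \<in> pverts G - {a, b}"
    have "edge_of G w \<in> uedges G" "edge_of G w \<noteq> {a, b}" using edge_of_mem[OF G] w by auto
    then have "\<not> g (edge_of G w) \<subseteq> g {a, b}" using inj_uniform_not_subset[OF g] ab by simp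
    then show "\<not> g (edge_of G w) \<subseteq> g (edge_of G a) \<union> g (edge_of G b)"
      using edge_of_eq[OF G(1) ab] by simp
  qed
  then show ?thesis by blast
qed

lemma ex_cff_disjoint_edges:
  assumes G: "disjoint_edges_graph n G" "even n" and "n div 2 \<le> t choose k"
  shows "\<exists>B. is_cff G (t + 2) B"
proof -
  obtain g where g: "inj_on g (uedges G)" "\<forall>e\<in>uedges G. g e \<subseteq> {1..t} \<and> card (g e) = k"
    using ex_uniform_edge_labelling[OF finite_uedges[OF G], of t k] assms
    by (auto simp: disjoint_edges_graph_def)
  \<comment> \<open>\<open>p\<close> selects one end of each edge. This end receives the additional
    point \<open>t + 1\<close> and the other end \<open>t + 2\<close>; both points lie outside all
    labels, so they cannot help to cover one.\<close>
  define p where "p e = (SOME v. v \<in> e)" for e :: "'a set"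
  have p: "p e \<in> e" if "e \<in> uedges G" for e
    using uedge_card[OF G that] by (auto simp: p_def some_in_eq)
  define h where "h v = (if v = p (edge_of G v) then t + 1 else t + 2)" for v
  define B where "B v = insert (h v) (g (edge_of G v))" for v
  have h: "t < h v" "h v \<le> t + 2" for v by (auto simp: h_def)
  have "is_cff G (t + 2) B"
    unfolding is_cff_def is_ecff_def
  proof (intro conjI ballI allI impI)
    fix v assume "v \<in> pverts G"
    then have "g (edge_of G v) \<subseteq> {1..t}" using g(2) edge_of_mem[OF G] by blast
    then show "B v \<subseteq> {1..t + 2}" using h[of v] by (auto simp: B_def)
  next
    fix a b w assume ab: "{a, b} \<in> uedges G" and w: "w \<in> pverts G - {a, b}"
    have e: "edge_of G w \<in> uedges G" "edge_of G w \<noteq> {a, b}" using edge_of_mem[OF G] w by auto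
    then have "\<not> g (edge_of G w) \<subseteq> g {a, b}" using inj_uniform_not_subset[OF g] ab by simp
    moreover have "g (edge_of G w) \<subseteq> {1..t}" using g(2) e by blast
    ultimately show "\<not> B w \<subseteq> B a \<union> B b"
      using edge_of_eq[OF G(1) ab] h(1)[of a] h(1)[of b] by (fastforce simp: B_def)
  next
    fix a b assume ab: "{a, b} \<in> uedges G"
    then have "a \<noteq> b" using uedge_card[OF G ab] by auto
    have eq: "edge_of G a = {a, b}" "edge_of G b = {a, b}" using edge_of_eq[OF G(1) ab] by auto
    have "h a \<noteq> h b" using p[OF ab] \<open>a \<noteq> b\<close> by (auto simp: h_def eq)
    moreover have "g {a, b} \<subseteq> {1..t}" using g(2) ab by blast
    ultimately show "\<not> B a \<subseteq> B b" "\<not> B b \<subseteq> B a"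
      using h(1)[of a] h(1)[of b] by (auto simp: B_def eq)
  qed
  then show ?thesis by blast
qed

section \<open>Lower bounds\<close>

lemma is_ecff_not_subset:
  assumes G: "disjoint_edges_graph n G" "even n" and B: "is_ecff G t B"
    and "v \<in> pverts G" "w \<in> pverts G" "w \<notin> edge_of G v"
  shows "\<not> B w \<subseteq> B v"
proof -
  obtain a b where ab: "edge_of G v = {a, b}"
    using uedge_card[OF G edge_of_mem(1)[OF G assms(4)]] by (auto simp: card_2_iff)
  have "{a, b} \<in> uedges G" "v \<in> {a, b}" using edge_of_mem[OF G assms(4)] ab by auto
  then have "\<not> B w \<subseteq> B a \<union> B b" using B assms(5,6) ab by (auto simp: is_ecff_def)
  then show ?thesis using \<open>v \<in> {a, b}\<close> by auto
qed

lemma is_ecff_disjoint_edges_bound: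
  assumes G: "disjoint_edges_graph n G" "even n" and B: "is_ecff G t B"
  shows "n div 2 \<le> t choose (t div 2)"
proof -
  define p where "p e = (SOME v. v \<in> e)" for e :: "'a set"
  have p: "p e \<in> e" if "e \<in> uedges G" for e
    using uedge_card[OF G that] by (auto simp: p_def some_in_eq)
  have pv: "p e \<in> pverts G" if "e \<in> uedges G" for e
    using p[OF that] that Union_uedges[OF G] by auto
  \<comment> \<open>This gives both that the chosen sets are distinct and that they form an
    antichain.\<close>
  have eq: "e = f" if "e \<in> uedges G" "f \<in> uedges G" "B (p e) \<subseteq> B (p f)" for e f
  proof -
    have "p e \<in> f"
      using is_ecff_not_subset[OF G B pv pv] that edge_of_eq[OF G(1) _ p] by metis
    then show ?thesis using edge_of_eq[OF G(1)] p that by metis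
  qed
  let ?F = "(\<lambda>e. B (p e)) ` uedges G"
  have "inj_on (\<lambda>e. B (p e)) (uedges G)" by (rule inj_onI, rule eq) auto
  then have "card ?F = n div 2" using G(1) by (simp add: card_image disjoint_edges_graph_def)
  moreover have "card ?F \<le> card {1..t} choose (card {1..t} div 2)"
  proof (rule sperner)
    show "?F \<subseteq> Pow {1..t}" using pv B by (auto simp: is_ecff_def)
    show "antichain ?F" unfolding antichain_def using eq by blast
  qed simp
  ultimately show ?thesis by simp
qed

lemma is_ecff_mono:
  assumes "is_ecff G s B" "s \<le> t"
  shows "is_ecff G t B"
proof -
  have "{1..s} \<subseteq> {1..t}" using assms(2) by auto
  then show ?thesis using assms(1) unfolding is_ecff_def by blast
qed

lemma is_cff_mono: "is_cff G s B \<Longrightarrow> s \<le> t \<Longrightarrow> is_cff G t B"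
  unfolding is_cff_def by (elim conjE, intro conjI) (rule is_ecff_mono)

text \<open>Ends of one edge are incomparable by the CFF condition, other vertices by the ECFF
  condition. So the sets form an extremal antichain, and some third member lies in the union over an
  edge.\<close>

lemma not_is_cff_disjoint_edges:
  assumes "4 \<le> t" and G: "disjoint_edges_graph (t choose (t div 2)) G" "even (t choose (t div 2))"
  shows "\<not> is_cff G t B"
proof
  assume B: "is_cff G t B"
  then have ec: "is_ecff G t B" by (simp add: is_cff_def)
  have eq: "v = w" if vw: "v \<in> pverts G" "w \<in> pverts G" "B w \<subseteq> B v" for v w
  proof (rule ccontr)
    assume "v \<noteq> w"
    have "w \<in> edge_of G v" using is_ecff_not_subset[OF G ec] vw by blast
    then have "edge_of G v = {v, w}"
      using \<open>v \<noteq> w\<close> uedge_card[OF G] edge_of_mem[OF G vw(1)] by (fastforce simp: card_2_iff)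
    then have "{v, w} \<in> uedges G" using edge_of_mem[OF G vw(1)] by simp
    then show False using B vw(3) by (auto simp: is_cff_def)
  qed
  let ?F = "B ` pverts G"
  have inj: "inj_on B (pverts G)" by (rule inj_onI) (auto intro: eq)
  then have card: "card ?F = card {1..t} choose (card {1..t} div 2)"
    using G(1) by (simp add: card_image disjoint_edges_graph_def)
  have anti: "antichain ?F" by (auto simp: antichain_def dest: eq)
  \<comment> \<open>The central coefficient is positive, so there is a vertex and hence an
    edge.\<close>
  have "0 < card (pverts G)" using G(1) by (simp add: disjoint_edges_graph_def)
  then obtain v where "v \<in> pverts G" by (metis card.empty equals0I less_irrefl)
  then have "edge_of G v \<in> uedges G" using edge_of_mem[OF G] by blast
  then obtain a b where ab: "{a, b} \<in> uedges G" "a \<noteq> b"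
    using uedge_card[OF G] by (metis card_2_iff)
  then have V: "a \<in> pverts G" "b \<in> pverts G" using Union_uedges[OF G] by auto
  have "\<exists>C\<in>?F - {B a, B b}. C \<subseteq> B a \<union> B b"
    by (rule extremal_antichain_third_below_union[OF _ _ _ anti card])
      (use assms(1) ec V ab(2) inj in \<open>auto simp: is_ecff_def dest: inj_onD\<close>)
  then obtain w where "w \<in> pverts G - {a, b}" "B w \<subseteq> B a \<union> B b" by auto
  then show False using ec ab(1) by (auto simp: is_ecff_def)
qed

theorem theorem5p10:
  fixes x N :: nat and G :: "'a pair_pre_digraph"
  assumes "x \<ge> 4"
    and "N = x choose (x div 2)"
    and "even N"
    and "disjoint_edges_graph N G"
  shows "t_cff G = x + 1 \<and> x + 1 = t_ecff G + 2"
proof -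
  note G = assms(4,3)
  \<comment> \<open>\<open>Suc y = x - 1\<close> is the value claimed for \<open>t_ecff G\<close>,
    and \<open>y\<close> is the largest size to be excluded.\<close>
  obtain y where y: "x = y + 2" "2 \<le> y" using assms(1) that[of "x - 2"] by simp
  have "x = Suc (Suc y)" using y(1) by simp
  then have "N \<le> 2 * (Suc y choose (Suc y div 2))"
    using central_binomial_Suc_le[of "Suc y"] assms(2) by (simp only:)
  then have half: "N div 2 \<le> Suc y choose (Suc y div 2)" by linarith
  have lower: "\<not> is_ecff G y B" for B
  proof
    assume "is_ecff G y B"
    then have "N div 2 \<le> y choose (y div 2)" by (rule is_ecff_disjoint_edges_bound[OF G])
    moreover have "2 * (y choose (y div 2)) < N"
      using central_binomial_add2_gt[OF y(2)] assms(2) y(1) by (simp only:)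
    \<comment> \<open>Evenness matters: for odd \<open>N\<close>, halving could lose the strict
      inequality.\<close>
    ultimately show False using assms(3) by (auto elim: evenE)
  qed
  have "t_ecff G = Suc y"
    unfolding t_ecff_def
  proof (rule Least_equality)
    show "\<exists>B. is_ecff G (Suc y) B" by (rule ex_ecff_disjoint_edges[OF G half])
    show "Suc y \<le> t" if "\<exists>B. is_ecff G t B" for t
      using that lower is_ecff_mono[of G t _ y] by (meson not_less_eq_eq)
  qed
  moreover have "t_cff G = x + 1"
    unfolding t_cff_def
  proof (rule Least_equality)
    \<comment> \<open>The labels again lie in \<open>{1..Suc y}\<close>; the two additional points
      give \<open>Suc y + 2 = x + 1\<close>.\<close>
    show "\<exists>B. is_cff G (x + 1) B" using ex_cff_disjoint_edges[OF G half] y(1) by simp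
    have "\<not> is_cff G x B" for B
      using not_is_cff_disjoint_edges[OF assms(1)] assms(2-4) by simp
    then show "x + 1 \<le> t" if "\<exists>B. is_cff G t B" for t
      using that is_cff_mono[of G t _ x] by (metis not_less_eq_eq Suc_eq_plus1)
  qed
  ultimately show ?thesis using y(1) by simp
qed

end
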